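(* Let $T\ge 1$, let $\mathcal{K}\subseteq\mathbb{R}^n$ be a closed $\beta_K$-strongly convex set ($\beta_K>0$) with $\mathbf{0}\in\mathcal{K}$ and $\|\mathbf{x}-\mathbf{y}\|_2\le D$ for all $\mathbf{x},\mathbf{y}\in\mathcal{K}$, and let $f_1,\dots,f_T:\mathcal{K}\to\mathbb{R}$ be convex (differentiable) functions with $\|\nabla f_t(\mathbf{x})\|_2\le G$ for all $\mathbf{x}\in\mathcal{K}$, $t\in[T]$, where $D,G>0$. Let $d_1,\dots,d_T\ge 1$ be arbitrary integer delays and $\bar d=\frac1T\sum_{t=1}^T d_t$. Let $\mathbf{x}_1,\dots,\mathbf{x}_T$ be the decisions played by Delayed OFW for convex losses (defined in the context) run with parameter $\eta=\frac{D}{2GT^{2/3}}$. Then for every $\mathbf{x}^\ast\in\mathcal{K}$, $$\sum_{t=1}^T f_t(\mathbf{x}_t)-\sum_{t=1}^T f_t(\mathbf{x}^\ast)\le G(3\sqrt\gamma+2D)T^{2/3}+\frac{GD(1+\bar d)T^{1/3}}{2},$$ where $\gamma=\max(4D^2,64/\beta_K^2)$.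
   Context: A convex set $\mathcal{K}\subseteq\mathbb{R}^n$ is $\beta_K$-strongly convex if $\gamma\mathbf{x}+(1-\gamma)\mathbf{y}+\gamma(1-\gamma)\frac{\beta_K}{2}\|\mathbf{x}-\mathbf{y}\|_2^2\,\mathbf{z}\in\mathcal{K}$ for all $\mathbf{x},\mathbf{y}\in\mathcal{K}$, $\gamma\in[0,1]$ and $\mathbf{z}\in\mathbb{R}^n$ with $\|\mathbf{z}\|_2=1$. Delayed online convex optimization: in each round $t=1,\dots,T$ the player plays $\mathbf{x}_t\in\mathcal{K}$, then the adversary selects a convex loss $f_t$; the gradient $\nabla f_t(\mathbf{x}_t)$ is revealed at the end of round $t+d_t-1$. Thus at the end of round $t$ the player receives $\{\nabla f_k(\mathbf{x}_k): k\in\mathcal{F}_t\}$, where $\mathcal{F}_t=\{k\in[T]: k+d_k-1=t\}$. Notation: $[T]=\{1,\dots,T\}$. Delayed OFW for convex losses (input $\eta$): choose an arbitrary $\mathbf{y}_1\in\mathcal{K}$, set $\tau=1$, $\bar{\mathbf{g}}_0=\mathbf{0}$. For $t=1,\dots,T$: play $\mathbf{x}_t=\mathbf{y}_\tau$ (with the current value of $\tau$); receive $\{\nabla f_k(\mathbf{x}_k):k\in\mathcal{F}_t\}$; for each $k\in\mathcal{F}_t$ (processed one after another, in any order) do: (i) $\bar{\mathbf{g}}_\tau=\bar{\mathbf{g}}_{\tau-1}+\nabla f_k(\mathbf{x}_k)$ and $F_\tau(\mathbf{y})=\eta\langle\bar{\mathbf{g}}_\tau,\mathbf{y}\rangle+\|\mathbf{y}-\mathbf{y}_1\|_2^2$;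 (ii) choose $\mathbf{v}_\tau\in\operatorname{argmin}_{\mathbf{y}\in\mathcal{K}}\langle\nabla F_\tau(\mathbf{y}_\tau),\mathbf{y}\rangle$; (iii) $\mathbf{y}_{\tau+1}=\mathbf{y}_\tau+\sigma_\tau(\mathbf{v}_\tau-\mathbf{y}_\tau)$, where $\sigma_\tau\in\operatorname{argmin}_{\sigma\in[0,1]}\langle\sigma(\mathbf{v}_\tau-\mathbf{y}_\tau),\nabla F_\tau(\mathbf{y}_\tau)\rangle+\sigma^2\|\mathbf{v}_\tau-\mathbf{y}_\tau\|_2^2$; then set $\tau\leftarrow\tau+1$. *)

theory Defs
  imports "HOL-Analysis.Analysis"
begin

definition strongly_convex_set :: "real \<Rightarrow> 'a::real_normed_vector set \<Rightarrow> bool" where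
  "strongly_convex_set \<beta> K \<longleftrightarrow> convex K \<and>
     (\<forall>x\<in>K. \<forall>y\<in>K. \<forall>\<gamma>\<in>{0..1}. \<forall>z. norm z = 1 \<longrightarrow>
        \<gamma> *\<^sub>R x + (1 - \<gamma>) *\<^sub>R y + (\<gamma> * (1 - \<gamma>) * (\<beta> / 2) * (norm (x - y))\<^sup>2) *\<^sub>R z \<in> K)"

text \<open>The indices of the gradients revealed at the end of round \<open>t\<close>. Every index is at least 1,
  so the natural-number subtraction does not truncate.\<close>

definition arrivals :: "nat \<Rightarrow> (nat \<Rightarrow> nat) \<Rightarrow> nat \<Rightarrow> nat set" where
  "arrivals T d t = {k \<in> {1..T}. k + d k - 1 = t}"

text \<open>The value of the update counter \<open>\<tau>\<close> at the beginning of round \<open>t\<close>: it starts at 1 and is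
  incremented once for every gradient received.\<close>

definition ofw_counter :: "nat \<Rightarrow> (nat \<Rightarrow> nat) \<Rightarrow> nat \<Rightarrow> nat" where
  "ofw_counter T d t = 1 + (\<Sum>s\<in>{1..<t}. card (arrivals T d s))"

definition ofw_objective :: "real \<Rightarrow> 'a::real_inner \<Rightarrow> 'a \<Rightarrow> 'a \<Rightarrow> real" where
  "ofw_objective \<eta> y1 gbar y = \<eta> * (gbar \<bullet> y) + (norm (y - y1))\<^sup>2"

text \<open>One Frank--Wolfe step with line search from \<open>y\<close> to \<open>y'\<close>; \<open>p\<close> is the gradient of the
  objective at \<open>y\<close>. Ties in both minimisations may be broken arbitrarily.\<close>

definition ofw_step ::
  "'a::real_inner set \<Rightarrow> real \<Rightarrow> 'a \<Rightarrow> 'a \<Rightarrow> 'a \<Rightarrow> 'a \<Rightarrow> bool" where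
  "ofw_step K \<eta> y1 gbar y y' \<longleftrightarrow>
     (\<exists>p v \<sigma>. GDERIV (ofw_objective \<eta> y1 gbar) y :> p \<and>
        is_arg_min (\<lambda>w. p \<bullet> w) (\<lambda>w. w \<in> K) v \<and>
        is_arg_min (\<lambda>s. (s *\<^sub>R (v - y)) \<bullet> p + s\<^sup>2 * (norm (v - y))\<^sup>2) (\<lambda>s. s \<in> {0..1::real}) \<sigma> \<and>
        y' = y + \<sigma> *\<^sub>R (v - y))"

text \<open>\<open>x 1, \<dots>, x T\<close> are decisions played by Delayed OFW for convex losses when the gradient
  of the \<open>k\<close>-th loss at \<open>w\<close> is \<open>grad k w\<close>. The function \<open>c\<close> gives the index \<open>c \<tau>\<close> of the gradient
  consumed by update \<open>\<tau>\<close>; it enumerates the gradients received in each round in an arbitrary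
  order. Since \<open>grad\<close> is unrestricted here, losses chosen adaptively are covered as well.\<close>

definition delayed_ofw_decisions ::
  "'a::real_inner set \<Rightarrow> real \<Rightarrow> nat \<Rightarrow> (nat \<Rightarrow> nat) \<Rightarrow> (nat \<Rightarrow> 'a \<Rightarrow> 'a) \<Rightarrow> (nat \<Rightarrow> 'a) \<Rightarrow> bool" where
  "delayed_ofw_decisions K \<eta> T d grad x \<longleftrightarrow>
     (\<exists>y gbar c. y 1 \<in> K \<and> gbar (0::nat) = 0 \<and>
        (\<forall>t\<in>{1..T}.
           x t = y (ofw_counter T d t) \<and>
           bij_betw c {ofw_counter T d t..<ofw_counter T d (t + 1)} (arrivals T d t) \<and>
           (\<forall>\<tau>\<in>{ofw_counter T d t..<ofw_counter T d (t + 1)}.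
              gbar \<tau> = gbar (\<tau> - 1) + grad (c \<tau>) (x (c \<tau>)) \<and>
              ofw_step K \<eta> (y 1) (gbar \<tau>) (y \<tau>) (y (\<tau> + 1)))))"

end

(* With the constant step parameter eta, of order T^(-2/3), the regularised objectives F_n start
   with optimality gap 0 at y_1. Adding one gradient raises a gap h by O(eta G sqrt h), while a
   Frank-Wolfe step over a strongly convex set lowers it by h/2 or by a multiple of h^(3/2), so all
   gaps stay below gamma T^(-2/3) / 4 and the iterates stay within O(T^(-1/3)) of the exact
   minimizers z_n. Hence a decision that misses m gradients is close to z_(n-m); stability of
   z_n (a projection, hence Lipschitz in the gradient sum) bounds its distance to z_n by
   O(eta G m), and z_n itself has regret D^2 / eta by the be-the-leader argument. Finally, the
   numbers of missed gradients sum up to at most the sum of the delays by double counting. *)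

theory Submission
  imports Defs
begin

section \<open>First-order convexity and strongly convex sets\<close>

text \<open>Convexity bounds each difference quotient of \<open>f\<close> along the segment from
  \<open>x\<close> to \<open>w\<close> by \<open>f w - f x\<close>; the quotients tend to the
  directional derivative. The limit is taken inside the segment because the derivative is given only
  within \<open>K\<close>.\<close>

lemma convex_on_gradient_ineq:
  fixes f :: "'a::real_inner \<Rightarrow> real"
  assumes f: "convex_on K f" and der: "(f has_derivative (\<lambda>h. h \<bullet> g)) (at x within K)"
    and x: "x \<in> K" and w: "w \<in> K"
  shows "f x - f w \<le> g \<bullet> (x - w)"
proof -
  have K: "convex K" using f by (rule convex_on_imp_convex)
  define \<phi> where "\<phi> s = x + s *\<^sub>R (w - x)" for s :: real
  have \<phi>_alt: "\<phi> s = (1 - s) *\<^sub>R x + s *\<^sub>R w" for s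
    by (simp add: \<phi>_def algebra_simps)
  have \<phi>K: "\<phi> ` {0..1} \<subseteq> K"
    using convexD_alt[OF K x w] by (auto simp: \<phi>_alt)
  have "(\<phi> has_derivative (\<lambda>s. s *\<^sub>R (w - x))) (at 0 within {0..1})"
    unfolding \<phi>_def by (auto intro!: derivative_eq_intros)
  moreover have "(f has_derivative (\<lambda>h. h \<bullet> g)) (at (\<phi> 0) within \<phi> ` {0..1})"
    using has_derivative_subset[OF der \<phi>K] by (simp add: \<phi>_def)
  ultimately have "((f \<circ> \<phi>) has_derivative (\<lambda>h. h \<bullet> g) \<circ> (\<lambda>s. s *\<^sub>R (w - x))) (at 0 within {0..1})"
    by (rule diff_chain_within)
  then have "((f \<circ> \<phi>) has_field_derivative (w - x) \<bullet> g) (at 0 within {0..1})"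
    unfolding has_field_derivative_def by (rule has_derivative_eq_rhs) (simp add: fun_eq_iff)
  then have lim: "((\<lambda>s. (f (\<phi> s) - f x) / s) \<longlongrightarrow> (w - x) \<bullet> g) (at 0 within {0..1})"
    by (simp add: has_field_derivative_iff \<phi>_def)
  have ev: "\<forall>\<^sub>F s in at 0 within {0..1}. (f (\<phi> s) - f x) / s \<le> f w - f x"
    unfolding eventually_at
  proof (intro exI[of _ 1] conjI ballI impI)
    fix s :: real assume s: "s \<in> {0..1}" "s \<noteq> 0 \<and> dist s 0 < 1"
    then have "f (\<phi> s) \<le> (1 - s) * f x + s * f w"
      using convex_onD[OF f, of s x w] x w by (simp add: \<phi>_alt)
    then have "f (\<phi> s) - f x \<le> (f w - f x) * s" by (simp add: algebra_simps)
    then show "(f (\<phi> s) - f x) / s \<le> f w - f x" using s by (simp add: divide_le_eq)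
  qed simp
  have "at (0::real) within {0..1} \<noteq> bot"
    by (simp add: trivial_limit_within)
  from tendsto_upperbound[OF lim ev this] show ?thesis
    by (simp add: algebra_simps inner_commute)
qed

text \<open>Moving from the midpoint of \<open>y\<close> and \<open>v\<close> against \<open>p\<close> stays in \<open>K\<close> by strong convexity,
  so optimality of \<open>v\<close> yields a Frank--Wolfe gap that is quadratic in \<open>norm (v - y)\<close>.\<close>

lemma strongly_convex_gap:
  fixes K :: "'a::real_inner set"
  assumes sc: "strongly_convex_set \<beta> K"
    and "y \<in> K" "v \<in> K" and min: "\<And>w. w \<in> K \<Longrightarrow> p \<bullet> v \<le> p \<bullet> w"
  shows "\<beta> / 4 * norm p * (norm (v - y))\<^sup>2 \<le> p \<bullet> (y - v)"
proof (cases "p = 0")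
  case False
  define z where "z = - (1 / norm p) *\<^sub>R p"
  have z: "norm z = 1" using False by (simp add: z_def)
  have pz: "p \<bullet> z = - norm p"
    using False by (simp add: z_def dot_square_norm power2_eq_square)
  have "(1/2) *\<^sub>R y + (1 - 1/2) *\<^sub>R v + ((1/2) * (1 - 1/2) * (\<beta> / 2) * (norm (y - v))\<^sup>2) *\<^sub>R z \<in> K"
    using sc assms(2,3) z unfolding strongly_convex_set_def by fastforce
  from min[OF this] show ?thesis
    by (simp add: inner_add_right inner_diff_right pz norm_minus_commute field_simps)
qed simp

section \<open>The regularised objective and its minimizer\<close>

text \<open>The objective is quadratic, so its second-order expansion is exact. Both the growth
  around the minimizer and the line search analysis rest on this.\<close>

lemma ofw_objective_expand:
  "ofw_objective \<eta> y1 g w = ofw_objective \<eta> y1 g u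
     + (\<eta> *\<^sub>R g + 2 *\<^sub>R (u - y1)) \<bullet> (w - u) + (norm (w - u))\<^sup>2"
  by (simp add: ofw_objective_def power2_norm_eq_inner algebra_simps inner_commute)

lemma GDERIV_ofw_objective:
  assumes "GDERIV (ofw_objective \<eta> y1 g) y :> p"
  shows "p = \<eta> *\<^sub>R g + 2 *\<^sub>R (y - y1)"
proof -
  have "(ofw_objective \<eta> y1 g has_derivative (\<lambda>h. h \<bullet> (\<eta> *\<^sub>R g + 2 *\<^sub>R (y - y1)))) (at y)"
    unfolding ofw_objective_def power2_norm_eq_inner
    by (rule derivative_eq_intros refl)+
      (simp add: fun_eq_iff inner_add_right inner_diff_right inner_commute[of g]
        inner_commute[of y] inner_commute[of y1] algebra_simps)
  with assms have "(\<lambda>h. h \<bullet> p) = (\<lambda>h. h \<bullet> (\<eta> *\<^sub>R g + 2 *\<^sub>R (y - y1)))"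
    unfolding gderiv_def by (rule has_derivative_unique)
  then show ?thesis by (simp only: fun_eq_iff vector_eq_ldot)
qed

text \<open>Completing the square shows that minimising the objective over \<open>K\<close> amounts to a projection.\<close>

definition ofw_minimizer :: "'a::euclidean_space set \<Rightarrow> real \<Rightarrow> 'a \<Rightarrow> 'a \<Rightarrow> 'a" where
  "ofw_minimizer K \<eta> y1 g = closest_point K (y1 - (\<eta> / 2) *\<^sub>R g)"

context
  fixes K :: "'a::euclidean_space set"
  assumes K: "closed K" "convex K" "K \<noteq> {}"
begin

lemma ofw_minimizer_in: "ofw_minimizer K \<eta> y1 g \<in> K"
  unfolding ofw_minimizer_def using K by (simp add: closest_point_in_set)

text \<open>The obtuse-angle property of the projection is first-order optimality at the minimizer;
  the exact expansion then leaves the squared distance. This turns objective gaps into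
  distances.\<close>

lemma ofw_minimizer_quadratic_growth:
  assumes "w \<in> K"
  shows "ofw_objective \<eta> y1 g (ofw_minimizer K \<eta> y1 g)
    + (norm (w - ofw_minimizer K \<eta> y1 g))\<^sup>2 \<le> ofw_objective \<eta> y1 g w"
proof -
  define z where "z = ofw_minimizer K \<eta> y1 g"
  have "((y1 - (\<eta> / 2) *\<^sub>R g) - z) \<bullet> (w - z) \<le> 0"
    unfolding z_def ofw_minimizer_def using K assms by (intro closest_point_dot) auto
  moreover have "\<eta> *\<^sub>R g + 2 *\<^sub>R (z - y1) = - 2 *\<^sub>R ((y1 - (\<eta> / 2) *\<^sub>R g) - z)"
    by (simp add: algebra_simps)
  ultimately have "0 \<le> (\<eta> *\<^sub>R g + 2 *\<^sub>R (z - y1)) \<bullet> (w - z)" by simp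
  then show ?thesis using ofw_objective_expand[of \<eta> y1 g w z] by (simp add: z_def)
qed

text \<open>Projections are nonexpansive, and the projected points differ by
  \<open>\<eta> / 2\<close> times the difference of the gradient sums.\<close>

lemma ofw_minimizer_lipschitz:
  assumes "0 \<le> \<eta>"
  shows "norm (ofw_minimizer K \<eta> y1 g - ofw_minimizer K \<eta> y1 g') \<le> \<eta> / 2 * norm (g - g')"
proof -
  have "dist (ofw_minimizer K \<eta> y1 g) (ofw_minimizer K \<eta> y1 g')
      \<le> dist (y1 - (\<eta> / 2) *\<^sub>R g) (y1 - (\<eta> / 2) *\<^sub>R g')"
    unfolding ofw_minimizer_def using K by (intro closest_point_lipschitz) auto
  also have "\<dots> = norm ((\<eta> / 2) *\<^sub>R (g' - g))" by (simp add: dist_norm algebra_simps)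
  also have "\<dots> = \<eta> / 2 * norm (g - g')" using assms by (simp add: norm_minus_commute)
  finally show ?thesis by (simp add: dist_norm)
qed

lemma ofw_minimizer_zero: "y1 \<in> K \<Longrightarrow> ofw_minimizer K \<eta> y1 0 = y1"
  by (simp add: ofw_minimizer_def closest_point_self)

text \<open>The leader \<open>z s\<close> already knows \<open>g s\<close>. Using optimality of
  \<open>z n\<close> against \<open>z (Suc n)\<close> inductively leaves only the regulariser at
  \<open>w\<close> as cost.\<close>

lemma be_the_leader:
  fixes g :: "nat \<Rightarrow> 'a" and \<eta> :: real and y1 :: 'a
  assumes "y1 \<in> K" "w \<in> K"
  defines "z \<equiv> \<lambda>n. ofw_minimizer K \<eta> y1 (\<Sum>s=1..n. g s)"
  shows "\<eta> * (\<Sum>s=1..n. g s \<bullet> (z s - w)) \<le> (norm (w - y1))\<^sup>2"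
proof -
  define F where "F n = ofw_objective \<eta> y1 (\<Sum>s=1..n. g s)" for n
  have min: "F n (z n) \<le> F n u" if "u \<in> K" for n u
    using ofw_minimizer_quadratic_growth[OF that, of \<eta> y1 "\<Sum>s=1..n. g s"]
    unfolding F_def z_def by (smt (verit) zero_le_power2)
  have "\<eta> * (\<Sum>s=1..n. g s \<bullet> z s) \<le> F n (z n)"
  proof (induction n)
    case 0
    then show ?case by (simp add: F_def ofw_objective_def)
  next
    case (Suc n)
    have "F n (z n) \<le> F n (z (Suc n))"
      by (rule min) (simp add: z_def ofw_minimizer_in)
    with Suc show ?case
      by (simp add: F_def ofw_objective_def algebra_simps)
  qed
  also have "F n (z n) \<le> F n w" using assms by (intro min)
  also have "F n w = \<eta> * (\<Sum>s=1..n. g s \<bullet> w) + (norm (w - y1))\<^sup>2"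
    by (simp add: F_def ofw_objective_def inner_sum_left)
  finally show ?thesis
    by (simp add: inner_diff_right sum_subtractf algebra_simps)
qed

section \<open>Progress of the Frank-Wolfe steps\<close>

lemma ofw_step_in:
  assumes "ofw_step K \<eta> y1 g y y'" "y \<in> K"
  shows "y' \<in> K"
proof -
  obtain v \<sigma> where v: "v \<in> K" "\<sigma> \<in> {0..1}" "y' = y + \<sigma> *\<^sub>R (v - y)"
    using assms(1) unfolding ofw_step_def is_arg_min_def by blast
  then have "y' = (1 - \<sigma>) *\<^sub>R y + \<sigma> *\<^sub>R v" by (simp add: algebra_simps)
  then show ?thesis using convexD_alt[OF K(2) assms(2) v(1)] v(2) by simp
qed

text \<open>The line search does at least as well as any fixed step size. Either a full step at
  least halves the gap \<open>s\<^sup>2\<close>, or the unclipped step size gains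
  \<open>q * q / (4 * A)\<close>, which strong convexity makes at least of order
  \<open>s ^ 3\<close>.\<close>

lemma ofw_step_decrease:
  fixes \<eta> :: real and y1 g :: 'a
  assumes step: "ofw_step K \<eta> y1 g y y'" and y: "y \<in> K"
    and sc: "strongly_convex_set \<beta> K" and \<beta>: "0 < \<beta>"
  defines "F \<equiv> ofw_objective \<eta> y1 g" and "z \<equiv> ofw_minimizer K \<eta> y1 g"
  assumes s: "0 \<le> s" "s\<^sup>2 = F y - F z"
  shows "F y' - F z \<le> s\<^sup>2 / 2 \<or> F y' - F z \<le> s\<^sup>2 - \<beta> / 8 * s ^ 3"
proof -
  obtain p v \<sigma> where p: "GDERIV F y :> p"
    and v_min: "is_arg_min (\<lambda>w. p \<bullet> w) (\<lambda>w. w \<in> K) v"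
    and \<sigma>_min: "is_arg_min (\<lambda>s. (s *\<^sub>R (v - y)) \<bullet> p + s\<^sup>2 * (norm (v - y))\<^sup>2)
                  (\<lambda>s. s \<in> {0..1}) \<sigma>"
    and y': "y' = y + \<sigma> *\<^sub>R (v - y)"
    using step unfolding ofw_step_def F_def by blast
  have vK: "v \<in> K" and v: "\<And>w. w \<in> K \<Longrightarrow> p \<bullet> v \<le> p \<bullet> w"
    using v_min unfolding is_arg_min_linorder by auto
  have \<sigma>: "(\<sigma> *\<^sub>R (v - y)) \<bullet> p + \<sigma>\<^sup>2 * (norm (v - y))\<^sup>2
      \<le> (r *\<^sub>R (v - y)) \<bullet> p + r\<^sup>2 * (norm (v - y))\<^sup>2" if "r \<in> {0..1}" for r
    using \<sigma>_min that unfolding is_arg_min_linorder by blast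
  have expand: "F w = F y + p \<bullet> (w - y) + (norm (w - y))\<^sup>2" for w
    using ofw_objective_expand[of \<eta> y1 g w y] GDERIV_ofw_objective[OF p[unfolded F_def]]
    by (simp add: F_def)
  define q where "q = p \<bullet> (y - v)"
  define A where "A = (norm (v - y))\<^sup>2"
  \<comment> \<open>Since the expansion is exact, the line search minimises \<open>F\<close> itself
    along the segment, so every \<open>r\<close> is a competitor.\<close>
  have dec: "F y' \<le> F y - r * q + r\<^sup>2 * A" if "r \<in> {0..1}" for r
  proof -
    have "F y' = F y + (\<sigma> *\<^sub>R (v - y)) \<bullet> p + \<sigma>\<^sup>2 * (norm (v - y))\<^sup>2"
      using expand[of y'] by (simp add: y' power_mult_distrib inner_commute)
    with \<sigma>[OF that] show ?thesis
      by (simp add: q_def A_def inner_commute inner_diff_left inner_diff_right algebra_simps)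
  qed
  have z: "z \<in> K" unfolding z_def by (rule ofw_minimizer_in)
  have sz: "s\<^sup>2 = p \<bullet> (y - z) - (norm (z - y))\<^sup>2"
    using expand[of z] s(2) by (simp add: inner_diff_right)
  have qs: "s\<^sup>2 \<le> q"
    using v[OF z] sz unfolding q_def inner_diff_right by (smt (verit) zero_le_power2)
  \<comment> \<open>As a function of \<open>norm (z - y)\<close>, the upper bound on the gap peaks
    at \<open>norm p / 2\<close>, with value \<open>(norm p)\<^sup>2 / 4\<close>.\<close>
  have ps: "2 * s \<le> norm p"
  proof -
    have "s\<^sup>2 \<le> norm p * norm (z - y) - (norm (z - y))\<^sup>2"
      using sz norm_cauchy_schwarz[of p "y - z"] by (simp add: norm_minus_commute)
    moreover have "0 \<le> (norm p - 2 * norm (z - y))\<^sup>2" by simp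
    ultimately have "(2 * s)\<^sup>2 \<le> (norm p)\<^sup>2" by (simp add: power2_eq_square algebra_simps)
    then show ?thesis by (rule power2_le_imp_le) simp
  qed
  have gap: "\<beta> / 4 * norm p * A \<le> q"
    unfolding A_def q_def using sc y vK v by (intro strongly_convex_gap)
  show ?thesis
  \<comment> \<open>For \<open>A > 0\<close> the quadratic in \<open>r\<close> is minimal at
    \<open>q / (2 * A)\<close>; the cases decide whether this lies below 1. The first case also
    covers \<open>A = 0\<close>.\<close>
  proof (cases "2 * A \<le> q")
    case True
    have "F y' \<le> F y - q + A" using dec[of 1] by simp
    then show ?thesis using True qs s(2) by (intro disjI1) linarith
  next
    case False
    have q0: "0 \<le> q" using qs by (smt (verit) zero_le_power2)
    have A: "0 < A" using False q0 by linarith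
    have "F y' \<le> F y - (q / (2 * A)) * q + (q / (2 * A))\<^sup>2 * A"
      using False q0 A by (intro dec) (simp add: divide_le_eq)
    also have "\<dots> = F y - q * q / (4 * A)"
      using A by (simp add: field_simps power2_eq_square)
    finally have 1: "F y' \<le> F y - q * q / (4 * A)" .
    \<comment> \<open>One factor \<open>q\<close> is bounded below through strong convexity, the
      other by \<open>s\<^sup>2\<close>; together they give the power 3.\<close>
    have "(\<beta> / 4 * (2 * s) * A) * s\<^sup>2 \<le> (\<beta> / 4 * norm p * A) * s\<^sup>2"
      using ps \<beta> A by (intro mult_right_mono mult_left_mono) auto
    also have "\<dots> \<le> q * q"
      using gap qs q0 by (intro mult_mono) auto
    finally have "\<beta> / 8 * s ^ 3 \<le> q * q / (4 * A)"
      using A by (simp add: field_simps power2_eq_square power3_eq_cube)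
    with 1 s(2) show ?thesis by (intro disjI2) linarith
  qed
qed

text \<open>Adding a gradient of norm at most \<open>a / \<eta>\<close> increases the gap from \<open>h\<close> to some \<open>s\<^sup>2\<close> with
  \<open>s\<^sup>2 \<le> h + a * s\<close>, which the Frank--Wolfe step compensates.\<close>

lemma ofw_gap_invariant:
  assumes step: "ofw_step K \<eta> y1 (g + g') y y'" and y: "y \<in> K"
    and sc: "strongly_convex_set \<beta> K" and \<beta>: "0 < \<beta>"
    and \<eta>: "0 \<le> \<eta>" and a: "\<eta> * norm g' \<le> a"
    and B: "2 * a\<^sup>2 \<le> B" "8 * a / \<beta> \<le> B"
    and gap: "ofw_objective \<eta> y1 g y - ofw_objective \<eta> y1 g (ofw_minimizer K \<eta> y1 g) \<le> B"
  shows "ofw_objective \<eta> y1 (g + g') y'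
    - ofw_objective \<eta> y1 (g + g') (ofw_minimizer K \<eta> y1 (g + g')) \<le> B"
proof -
  define F where "F = ofw_objective \<eta> y1 (g + g')"
  define z where "z = ofw_minimizer K \<eta> y1 (g + g')"
  define s where "s = sqrt (F y - F z)"
  have growth: "F z + (norm (y - z))\<^sup>2 \<le> F y"
    unfolding F_def z_def using y by (rule ofw_minimizer_quadratic_growth)
  have s0: "0 \<le> F y - F z" using growth by (smt (verit) zero_le_power2)
  have s: "0 \<le> s" "s\<^sup>2 = F y - F z" using s0 by (simp_all add: s_def)
  have "norm (y - z) \<le> s"
    unfolding s_def using growth by (intro real_le_rsqrt) simp
  have a0: "0 \<le> a" using a \<eta> by (smt (verit) mult_nonneg_nonneg norm_ge_zero)
  have "F y - F z = ofw_objective \<eta> y1 g y - ofw_objective \<eta> y1 g z + \<eta> * (g' \<bullet> (y - z))"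
    by (simp add: F_def ofw_objective_def algebra_simps)
  moreover have "ofw_objective \<eta> y1 g (ofw_minimizer K \<eta> y1 g) \<le> ofw_objective \<eta> y1 g z"
    using ofw_minimizer_quadratic_growth[of z \<eta> y1 g] ofw_minimizer_in
    unfolding z_def by (smt (verit) zero_le_power2)
  moreover have "\<eta> * (g' \<bullet> (y - z)) \<le> a * s"
  proof -
    have "\<eta> * (g' \<bullet> (y - z)) \<le> \<eta> * (norm g' * norm (y - z))"
      using \<eta> by (intro mult_left_mono norm_cauchy_schwarz)
    also have "\<dots> \<le> a * s"
      using a \<open>norm (y - z) \<le> s\<close> a0 unfolding mult.assoc[symmetric] by (intro mult_mono) auto
    finally show ?thesis .
  qed
  ultimately have drift: "s\<^sup>2 \<le> B + a * s" using gap s(2) by linarith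
  have "F y' - F z \<le> s\<^sup>2 / 2 \<or> F y' - F z \<le> s\<^sup>2 - \<beta> / 8 * s ^ 3"
    unfolding F_def z_def
    by (rule ofw_step_decrease[OF step y sc \<beta> s(1)]) (simp add: s(2) F_def z_def)
  then have "F y' - F z \<le> B"
  proof
    assume h: "F y' - F z \<le> s\<^sup>2 / 2"
    \<comment> \<open>A new gap above \<open>B\<close> would force \<open>s < 2 * a\<close> and
      \<open>B < a * s\<close>, contradicting \<open>2 * a\<^sup>2 \<le> B\<close>.\<close>
    show ?thesis
    proof (rule ccontr)
      assume "\<not> ?thesis"
      with h drift have "B < a * s" "s\<^sup>2 < 2 * (a * s)" by linarith+
      then have "s * s < s * (2 * a)" by (simp add: power2_eq_square algebra_simps)
      then have "s < 2 * a" using s(1) by (simp add: mult_less_cancel_left)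
      then have "a * s \<le> a * (2 * a)" using a0 by (intro mult_left_mono) auto
      with B(1) \<open>B < a * s\<close> show False by (simp add: power2_eq_square)
    qed
  next
    assume h: "F y' - F z \<le> s\<^sup>2 - \<beta> / 8 * s ^ 3"
    show ?thesis
    \<comment> \<open>From this threshold on, the decrease \<open>\<beta> / 8 * s ^ 3\<close> pays
      for the drift \<open>a * s\<close>; below it, \<open>s\<^sup>2\<close> is already at most
      \<open>8 * a / \<beta>\<close>.\<close>
    proof (cases "8 * a \<le> \<beta> * s\<^sup>2")
      case True
      then have "8 * a * s \<le> \<beta> * s\<^sup>2 * s" using s(1) by (rule mult_right_mono)
      then have "a * s \<le> \<beta> / 8 * s ^ 3" by (simp add: power2_eq_square power3_eq_cube)
      with h drift show ?thesis by linarith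
    next
      case False
      then have "s\<^sup>2 \<le> 8 * a / \<beta>" using \<beta> by (simp add: field_simps)
      moreover have "0 \<le> \<beta> / 8 * s ^ 3" using \<beta> s(1) by simp
      ultimately show ?thesis using h B(2) by linarith
    qed
  qed
  then show ?thesis by (simp add: F_def z_def)
qed

lemma ofw_iterates_in:
  fixes y :: "nat \<Rightarrow> 'a"
  assumes "y 1 \<in> K" "\<And>\<tau>. \<tau> \<in> {1..<m} \<Longrightarrow> ofw_step K \<eta> (y 1) (g \<tau>) (y \<tau>) (y (\<tau> + 1))"
    and "\<tau> \<in> {1..m}"
  shows "y \<tau> \<in> K"
proof -
  have "1 \<le> \<tau>" using assms(3) by simp
  then show ?thesis using assms(3)
  proof (induction \<tau> rule: nat_induct_at_least)
    case (Suc \<tau>)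
    then show ?case using ofw_step_in[OF assms(2)[of \<tau>]] by simp
  qed (use assms in simp)
qed

text \<open>The gap invariant holds along the run by induction, and quadratic growth converts it
  into a distance. The index is \<open>\<tau> - 1\<close> because \<open>y \<tau>\<close> is built
  before \<open>g \<tau>\<close> is added.\<close>

lemma ofw_iterates_close:
  fixes y :: "nat \<Rightarrow> 'a"
  assumes y1: "y 1 \<in> K"
    and step: "\<And>\<tau>. \<tau> \<in> {1..<m} \<Longrightarrow> ofw_step K \<eta> (y 1) (\<Sum>s=1..\<tau>. g s) (y \<tau>) (y (\<tau> + 1))"
    and g: "\<And>\<tau>. \<tau> \<in> {1..<m} \<Longrightarrow> \<eta> * norm (g \<tau>) \<le> a"
    and sc: "strongly_convex_set \<beta> K" and \<beta>: "0 < \<beta>" and \<eta>: "0 \<le> \<eta>"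
    and B: "2 * a\<^sup>2 \<le> B\<^sup>2" "8 * a / \<beta> \<le> B\<^sup>2" "0 \<le> B"
    and \<tau>: "\<tau> \<in> {1..m}"
  shows "norm (y \<tau> - ofw_minimizer K \<eta> (y 1) (\<Sum>s=1..\<tau> - 1. g s)) \<le> B"
proof -
  define F where "F \<tau> = ofw_objective \<eta> (y 1) (\<Sum>s=1..\<tau> - 1. g s)" for \<tau>
  define z where "z \<tau> = ofw_minimizer K \<eta> (y 1) (\<Sum>s=1..\<tau> - 1. g s)" for \<tau>
  have yK: "y \<tau> \<in> K" if "\<tau> \<in> {1..m}" for \<tau>
    using ofw_iterates_in[where g = "\<lambda>\<tau>. \<Sum>s=1..\<tau>. g s", OF y1 step that] by simp
  have "1 \<le> \<tau>" using \<tau> by simp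
  then have "F \<tau> (y \<tau>) - F \<tau> (z \<tau>) \<le> B\<^sup>2" using \<tau>
  proof (induction \<tau> rule: nat_induct_at_least)
    case base
    then show ?case using y1 by (simp add: z_def ofw_minimizer_zero)
  next
    case (Suc \<tau>)
    then have \<tau>: "\<tau> \<in> {1..<m}" "\<tau> \<in> {1..m}" by auto
    have sum: "(\<Sum>s=1..\<tau>. g s) = (\<Sum>s=1..\<tau> - 1. g s) + g \<tau>"
      using \<open>1 \<le> \<tau>\<close> by (cases \<tau>) auto
    have "F \<tau> (y \<tau>) - F \<tau> (z \<tau>) \<le> B\<^sup>2" using Suc.IH \<tau> by simp
    from ofw_gap_invariant[OF step[OF \<tau>(1), unfolded sum] yK[OF \<tau>(2)] sc \<beta> \<eta> g[OF \<tau>(1)] B(1,2)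
        this[unfolded F_def z_def]]
    show ?case by (simp only: F_def z_def sum Suc_eq_plus1 add_diff_cancel_right')
  qed
  then have "(norm (y \<tau> - z \<tau>))\<^sup>2 \<le> B\<^sup>2"
    using ofw_minimizer_quadratic_growth[OF yK[OF \<tau>], of \<eta> "y 1" "\<Sum>s=1..\<tau> - 1. g s"]
    unfolding F_def z_def by linarith
  then show ?thesis using B(3) unfolding z_def by (rule power2_le_imp_le)
qed

text \<open>Each further gradient costs at most \<open>\<eta> / 2 * G\<close> by Lipschitz
  continuity. This prices the gradients that a decision misses.\<close>

lemma ofw_minimizer_drift:
  assumes "0 \<le> \<eta>" "m \<le> n" and g: "\<And>s. s \<in> {1..n} \<Longrightarrow> norm (g s) \<le> G"
  shows "norm (ofw_minimizer K \<eta> y1 (\<Sum>s=1..m. g s) - ofw_minimizer K \<eta> y1 (\<Sum>s=1..n. g s))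
    \<le> \<eta> / 2 * (real (n - m) * G)"
proof -
  have "{1..n} = {1..m} \<union> {Suc m..n}" using \<open>m \<le> n\<close> by auto
  then have "(\<Sum>s=1..n. g s) = (\<Sum>s=1..m. g s) + (\<Sum>s=Suc m..n. g s)"
    by (simp add: sum.union_disjoint)
  then have "norm ((\<Sum>s=1..m. g s) - (\<Sum>s=1..n. g s)) = norm (\<Sum>s=Suc m..n. g s)"
    by simp
  also have "\<dots> \<le> (\<Sum>s=Suc m..n. G)" using g by (intro sum_norm_le) auto
  also have "\<dots> = real (n - m) * G" by simp
  finally show ?thesis
    using ofw_minimizer_lipschitz[OF \<open>0 \<le> \<eta>\<close>, of y1 "\<Sum>s=1..m. g s" "\<Sum>s=1..n. g s"] \<open>0 \<le> \<eta>\<close>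
    by (meson divide_nonneg_nonneg mult_left_mono order_trans zero_le_numeral)
qed

end

section \<open>Counting updates and delays\<close>

lemma ofw_counter_1 [simp]: "ofw_counter T d (Suc 0) = 1"
  by (simp add: ofw_counter_def)

lemma ofw_counter_ge_1: "1 \<le> ofw_counter T d t"
  by (simp add: ofw_counter_def)

lemma ofw_counter_mono: "s \<le> t \<Longrightarrow> ofw_counter T d s \<le> ofw_counter T d t"
  unfolding ofw_counter_def by (intro add_left_mono sum_mono2) auto

text \<open>The counter ranges of consecutive rounds tile the updates. This recovers the round of a
  given update, so that facts about rounds apply to single updates.\<close>

lemma ofw_counter_block:
  assumes "\<tau> \<in> {1..<ofw_counter T d (Suc m)}"
  obtains t where "t \<in> {1..m}" "\<tau> \<in> {ofw_counter T d t..<ofw_counter T d (Suc t)}"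
  using assms
proof (induction m arbitrary: thesis)
  case (Suc m)
  show ?case
  proof (cases "\<tau> < ofw_counter T d (Suc m)")
    case True
    then obtain t where "t \<in> {1..m}" "\<tau> \<in> {ofw_counter T d t..<ofw_counter T d (Suc t)}"
      using Suc.IH Suc.prems(2) by auto
    then show ?thesis by (intro Suc.prems(1)[of t]) auto
  next
    case False
    then show ?thesis using Suc.prems by (intro Suc.prems(1)[of "Suc m"]) auto
  qed
qed simp

text \<open>A gradient has only one arrival round, so the arrival sets are disjoint and the
  bijections of the rounds glue together.\<close>

lemma bij_betw_arrivals:
  assumes "\<And>t. t \<in> {1..m} \<Longrightarrow>
    bij_betw c {ofw_counter T d t..<ofw_counter T d (Suc t)} (arrivals T d t)"
  shows "bij_betw c {1..<ofw_counter T d (Suc m)} (\<Union>t\<in>{1..m}. arrivals T d t)"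
  using assms
proof (induction m)
  case (Suc m)
  have "bij_betw c ({1..<ofw_counter T d (Suc m)} \<union>
      {ofw_counter T d (Suc m)..<ofw_counter T d (Suc (Suc m))})
      ((\<Union>t\<in>{1..m}. arrivals T d t) \<union> arrivals T d (Suc m))"
    by (intro bij_betw_combine Suc) (auto simp: arrivals_def intro!: Suc)
  also have "{1..<ofw_counter T d (Suc m)} \<union>
      {ofw_counter T d (Suc m)..<ofw_counter T d (Suc (Suc m))} = {1..<ofw_counter T d (Suc (Suc m))}"
    using ofw_counter_mono[of "Suc m" "Suc (Suc m)" T d] ofw_counter_ge_1[of T d "Suc m"]
    by auto
  also have "(\<Union>t\<in>{1..m}. arrivals T d t) \<union> arrivals T d (Suc m) = (\<Union>t\<in>{1..Suc m}. arrivals T d t)"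
    by (simp add: atLeastAtMostSuc_conv Un_commute)
  finally show ?case .
qed (simp add: bij_betw_def)

text \<open>Gradient \<open>k\<close> is counted when \<open>k + d k - 1 < t\<close>; delays of at
  least 1 place this arrival in round 1 or later, where the sum over rounds begins.\<close>

lemma ofw_counter_eq_sum:
  assumes "\<And>k. k \<in> {1..T} \<Longrightarrow> d k \<ge> 1"
  shows "ofw_counter T d t = 1 + (\<Sum>k=1..T. if k + d k \<le> t then 1 else 0)"
proof -
  have "(\<Sum>s\<in>{1..<t}. card (arrivals T d s)) =
      (\<Sum>s\<in>{1..<t}. \<Sum>k=1..T. if k + d k - 1 = s then 1 else 0)"
    unfolding arrivals_def
    by (intro sum.cong refl) (simp add: sum.If_cases Int_def)
  also have "\<dots> = (\<Sum>k=1..T. \<Sum>s\<in>{1..<t}. if k + d k - 1 = s then 1 else 0)"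
    by (rule sum.swap)
  also have "\<dots> = (\<Sum>k=1..T. if k + d k \<le> t then 1 else 0)"
    using assms by (intro sum.cong refl) (fastforce simp: sum.delta)
  finally show ?thesis by (simp add: ofw_counter_def)
qed

text \<open>The summand counts the gradients of rounds up to \<open>t\<close> that are missing when
  round \<open>t\<close> begins, its own included. Counted by gradient instead, \<open>k\<close> is
  missing in at most \<open>d k\<close> rounds.\<close>

lemma sum_ofw_counter:
  assumes d: "\<And>k. k \<in> {1..T} \<Longrightarrow> d k \<ge> 1"
  shows "(\<Sum>t=1..T. real t + 1 - real (ofw_counter T d t)) \<le> (\<Sum>k=1..T. real (d k))"
proof -
  have counter: "ofw_counter T d t = 1 + (\<Sum>k=1..T. if k + d k \<le> t then 1 else 0)" for t
    using d by (rule ofw_counter_eq_sum)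
  have total: "(\<Sum>t=1..T. real (ofw_counter T d t)) =
      real T + (\<Sum>t=1..T. \<Sum>k=1..T. if k + d k \<le> t then 1 else 0)"
    by (simp add: counter sum.distrib if_distrib[of real] cong: if_cong)
  have "(\<Sum>t=1..T. \<Sum>k=1..T. if k + d k \<le> t then 1 else (0::real)) =
      (\<Sum>k=1..T. \<Sum>t=1..T. if k + d k \<le> t then 1 else 0)"
    by (rule sum.swap)
  \<comment> \<open>Only an inequality: for a gradient arriving after round \<open>T\<close> the
    real difference is negative, while \<open>{k + d k..T}\<close> is empty.\<close>
  also have "\<dots> \<ge> (\<Sum>k=1..T. real T + 1 - real k - real (d k))"
  proof (rule sum_mono)
    fix k assume "k \<in> {1..T}"
    have "(\<Sum>t=1..T. if k + d k \<le> t then 1 else (0::real)) = real (card {t \<in> {1..T}. k + d k \<le> t})"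
      by (simp add: sum.If_cases Int_def)
    also have "{t \<in> {1..T}. k + d k \<le> t} = {k + d k..T}" using \<open>k \<in> {1..T}\<close> by auto
    finally show "real T + 1 - real k - real (d k) \<le> (\<Sum>t=1..T. if k + d k \<le> t then 1 else 0)"
      by simp
  qed
  finally have "real T + (\<Sum>k=1..T. real T + 1 - real k - real (d k)) \<le> (\<Sum>t=1..T. real (ofw_counter T d t))"
    using total by linarith
  moreover have "(\<Sum>k=1..T. real k) = real T * (real T + 1) / 2"
    by (induction T) (simp_all add: field_simps)
  ultimately show ?thesis
    by (simp add: sum.distrib sum_subtractf algebra_simps)
qed

text \<open>The complements of \<open>A\<close> and \<open>C\<close> have equal finite cardinality.
  This serves to complete the order of consumption to a permutation of all rounds.\<close>

lemma bij_betw_extend: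
  assumes c: "bij_betw c A C" and "A \<subseteq> A'" "C \<subseteq> C'" "finite A'" "finite C'" "card A' = card C'"
  obtains c' where "bij_betw c' A' C'" "\<And>a. a \<in> A \<Longrightarrow> c' a = c a"
proof -
  have "card (A' - A) = card (C' - C)"
    using assms bij_betw_same_card[OF c] by (simp add: card_Diff_subset finite_subset)
  then obtain e where e: "bij_betw e (A' - A) (C' - C)"
    using assms finite_same_card_bij[of "A' - A" "C' - C"] by auto
  define c' where "c' a = (if a \<in> A then c a else e a)" for a
  have "bij_betw c' A C" using c by (simp add: c'_def cong: bij_betw_cong)
  moreover have "bij_betw c' (A' - A) (C' - C)"
    using e by (rule bij_betw_cong[THEN iffD1, rotated]) (simp add: c'_def)
  ultimately have "bij_betw c' (A \<union> (A' - A)) (C \<union> (C' - C))"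
    by (rule bij_betw_combine) auto
  moreover have "A \<union> (A' - A) = A'" "C \<union> (C' - C) = C'" using assms by auto
  ultimately show thesis using that[of c'] by (simp add: c'_def)
qed

section \<open>The regret bound\<close>

theorem theorem4:
  fixes K :: "(real ^ 'n) set"
    and f :: "nat \<Rightarrow> real ^ 'n \<Rightarrow> real"
    and grad :: "nat \<Rightarrow> real ^ 'n \<Rightarrow> real ^ 'n"
    and x :: "nat \<Rightarrow> real ^ 'n"
    and xstar :: "real ^ 'n"
    and d :: "nat \<Rightarrow> nat"
    and T :: nat
    and \<beta>\<^sub>K D G :: real
  assumes "T \<ge> 1"
    and "closed K" and "\<beta>\<^sub>K > 0" and "strongly_convex_set \<beta>\<^sub>K K" and "0 \<in> K"
    and "D > 0" and "\<And>u w. u \<in> K \<Longrightarrow> w \<in> K \<Longrightarrow> norm (u - w) \<le> D"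
    and "\<And>t. t \<in> {1..T} \<Longrightarrow> convex_on K (f t)"
    and "\<And>t w. t \<in> {1..T} \<Longrightarrow> w \<in> K \<Longrightarrow>
           (f t has_derivative (\<lambda>h. h \<bullet> grad t w)) (at w within K)"
    and "G > 0" and "\<And>t w. t \<in> {1..T} \<Longrightarrow> w \<in> K \<Longrightarrow> norm (grad t w) \<le> G"
    and "\<And>t. t \<in> {1..T} \<Longrightarrow> d t \<ge> 1"
    and "delayed_ofw_decisions K (D / (2 * G * real T powr (2 / 3))) T d grad x"
    and "xstar \<in> K"
  shows "(\<Sum>t = 1..T. f t (x t)) - (\<Sum>t = 1..T. f t xstar)
    \<le> G * (3 * sqrt (max (4 * D\<^sup>2) (64 / \<beta>\<^sub>K\<^sup>2)) + 2 * D) * real T powr (2 / 3)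
      + G * D * (1 + (1 / real T) * (\<Sum>t = 1..T. real (d t))) * real T powr (1 / 3) / 2"
proof -
  define \<eta> where "\<eta> = D / (2 * G * real T powr (2 / 3))"
  define \<rho> where "\<rho> = real T powr (- 1 / 3)"
  define \<gamma> where "\<gamma> = max (4 * D\<^sup>2) (64 / \<beta>\<^sub>K\<^sup>2)"
  define \<delta> where "\<delta> = (1 / real T) * (\<Sum>t=1..T. real (d t))"
  have \<delta>0: "0 \<le> \<delta>" by (simp add: \<delta>_def sum_nonneg)
  define N where "N = ofw_counter T d"
  note d = assms(12)
  have K: "closed K" "convex K" "K \<noteq> {}"
    using assms(2,4,5) by (auto simp: strongly_convex_set_def)
  obtain y gbar c where y1: "y 1 \<in> K" and gbar0: "gbar (0::nat) = 0"
    and x: "\<And>t. t \<in> {1..T} \<Longrightarrow> x t = y (N t)"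
    and c: "\<And>t. t \<in> {1..T} \<Longrightarrow> bij_betw c {N t..<N (Suc t)} (arrivals T d t)"
    and run: "\<And>t \<tau>. t \<in> {1..T} \<Longrightarrow> \<tau> \<in> {N t..<N (Suc t)} \<Longrightarrow>
              gbar \<tau> = gbar (\<tau> - 1) + grad (c \<tau>) (x (c \<tau>)) \<and>
              ofw_step K \<eta> (y 1) (gbar \<tau>) (y \<tau>) (y (\<tau> + 1))"
    using assms(13) unfolding delayed_ofw_decisions_def \<eta>_def N_def Suc_eq_plus1 by blast
  define M where "M = N (Suc T)"
  have c_bij: "bij_betw c {1..<M} (\<Union>t\<in>{1..T}. arrivals T d t)"
    using bij_betw_arrivals[of T c T d] c by (simp add: N_def M_def)
  have sub: "(\<Union>t\<in>{1..T}. arrivals T d t) \<subseteq> {1..T}" by (auto simp: arrivals_def)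
  have "M - 1 \<le> T"
    using bij_betw_same_card[OF c_bij] card_mono[OF _ sub] by simp
  then have "{1..<M} \<subseteq> {1..T}" by auto
  \<comment> \<open>Gradients that arrive after round \<open>T\<close> are appended to the order of consumption; they enter
    only the minimizers of the objectives, never the iterates.\<close>
  then obtain c' where c': "bij_betw c' {1..T} {1..T}" "\<And>\<tau>. \<tau> \<in> {1..<M} \<Longrightarrow> c' \<tau> = c \<tau>"
    by (rule bij_betw_extend[OF c_bij _ sub]) auto
  \<comment> \<open>Gradients in order of consumption, each taken at the decision of its own round
    \<open>c' \<tau>\<close>.\<close>
  define g where "g \<tau> = grad (c' \<tau>) (x (c' \<tau>))" for \<tau>
  define z where "z n = ofw_minimizer K \<eta> (y 1) (\<Sum>s=1..n. g s)" for n
  have c'T: "c' \<tau> \<in> {1..T}" if "\<tau> \<in> {1..T}" for \<tau>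
    using c'(1) that by (rule bij_betwE[rule_format])
  have upd: "gbar \<tau> = gbar (\<tau> - 1) + g \<tau>"
    and step: "ofw_step K \<eta> (y 1) (gbar \<tau>) (y \<tau>) (y (\<tau> + 1))" if \<tau>: "\<tau> \<in> {1..<M}" for \<tau>
  proof -
    obtain t where "t \<in> {1..T}" "\<tau> \<in> {N t..<N (Suc t)}"
      using \<tau> unfolding M_def N_def by (rule ofw_counter_block)
    with run show "gbar \<tau> = gbar (\<tau> - 1) + g \<tau>"
      "ofw_step K \<eta> (y 1) (gbar \<tau>) (y \<tau>) (y (\<tau> + 1))"
      unfolding g_def c'(2)[OF \<tau>] by blast+
  qed
  have gbar: "gbar \<tau> = (\<Sum>s=1..\<tau>. g s)" if "\<tau> < M" for \<tau>
    using that
  proof (induction \<tau>)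
    case (Suc \<tau>)
    then show ?case using upd[of "Suc \<tau>"] by simp
  qed (simp add: gbar0)
  have N_range: "N t \<in> {1..M}" if "t \<in> {1..T}" for t
    using ofw_counter_ge_1[of T d t] ofw_counter_mono[of t "Suc T" T d] that
    by (simp add: N_def M_def)
  have xK: "x t \<in> K" if "t \<in> {1..T}" for t
    using ofw_iterates_in[OF K y1 step N_range[OF that]] x[OF that] by simp
  have gG: "norm (g \<tau>) \<le> G" if "\<tau> \<in> {1..T}" for \<tau>
    using assms(11) c'T[OF that] xK by (simp add: g_def)
  have \<eta>0: "0 < \<eta>" unfolding \<eta>_def using \<open>T \<ge> 1\<close> \<open>D > 0\<close> \<open>G > 0\<close> by simp
  have \<rho>0: "0 < \<rho>" using \<open>T \<ge> 1\<close> by (simp add: \<rho>_def)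
  have \<rho>1: "\<rho> \<le> 1"
    using powr_mono[of "- 1 / 3" 0 "real T"] \<open>T \<ge> 1\<close> by (simp add: \<rho>_def)
  have \<rho>2: "\<rho>\<^sup>2 = real T powr - (2 / 3)"
    by (simp add: \<rho>_def power2_eq_square flip: powr_add)
  have powr23: "real T powr (2 / 3) = real T * \<rho>"
    using powr_add[of "real T" 1 "- 1 / 3"] \<open>T \<ge> 1\<close> by (simp add: \<rho>_def)
  have powr23': "real T powr (2 / 3) = 1 / \<rho>\<^sup>2"
    unfolding \<rho>2 powr_minus_divide by simp
  have powr13: "real T powr (1 / 3) = real T * \<rho>\<^sup>2"
    using powr_add[of "real T" 1 "- (2 / 3)"] \<open>T \<ge> 1\<close> by (simp add: \<rho>2)
  have \<eta>G: "\<eta> * G = D * \<rho>\<^sup>2 / 2"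
    unfolding \<eta>_def powr23' using \<open>G > 0\<close> by simp
  \<comment> \<open>With \<open>a = \<eta> * G\<close>, this \<open>B\<close> meets both size
    conditions of \<open>ofw_iterates_close\<close>.\<close>
  define B where "B = sqrt \<gamma> * \<rho> / 2"
  have \<gamma>D: "4 * D\<^sup>2 \<le> \<gamma>" and \<gamma>\<beta>: "64 / \<beta>\<^sub>K\<^sup>2 \<le> \<gamma>" by (simp_all add: \<gamma>_def)
  have \<gamma>0: "0 \<le> \<gamma>" using \<gamma>D by (smt (verit) zero_le_power2)
  have B2: "B\<^sup>2 = \<gamma> * \<rho>\<^sup>2 / 4"
    using \<gamma>0 by (simp add: B_def power_divide power_mult_distrib)
  have "2 * (\<eta> * G)\<^sup>2 \<le> B\<^sup>2"
  proof -
    have "(\<rho>\<^sup>2)\<^sup>2 \<le> \<rho>\<^sup>2"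
      using \<rho>0 \<rho>1 by (simp add: power2_eq_square mult_le_one)
    then have "D\<^sup>2 * (\<rho>\<^sup>2)\<^sup>2 \<le> D\<^sup>2 * \<rho>\<^sup>2" by (intro mult_left_mono) auto
    moreover have "4 * D\<^sup>2 * \<rho>\<^sup>2 \<le> \<gamma> * \<rho>\<^sup>2" using \<gamma>D by (intro mult_right_mono) auto
    moreover have "0 \<le> D\<^sup>2 * \<rho>\<^sup>2" by simp
    moreover have "2 * (\<eta> * G)\<^sup>2 = D\<^sup>2 * (\<rho>\<^sup>2)\<^sup>2 / 2"
      by (simp add: \<eta>G power_divide power_mult_distrib)
    ultimately show ?thesis unfolding B2 by linarith
  qed
  moreover have "8 * (\<eta> * G) / \<beta>\<^sub>K \<le> B\<^sup>2"
  proof -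
    \<comment> \<open>\<open>16 * D / \<beta>\<^sub>K\<close> is the geometric mean of the two terms
      in \<open>\<gamma>\<close>, hence at most their maximum.\<close>
    have "0 \<le> (2 * D - 8 / \<beta>\<^sub>K)\<^sup>2" by simp
    then have "32 * D / \<beta>\<^sub>K \<le> 4 * D\<^sup>2 + 64 / \<beta>\<^sub>K\<^sup>2"
      by (simp add: power2_diff power_divide power_mult_distrib)
    then have "16 * D / \<beta>\<^sub>K \<le> \<gamma>" using \<gamma>D \<gamma>\<beta> by linarith
    then have "16 * D / \<beta>\<^sub>K * \<rho>\<^sup>2 \<le> \<gamma> * \<rho>\<^sup>2" by (intro mult_right_mono) auto
    then show ?thesis unfolding \<eta>G B2 by simp
  qed
  moreover have B0: "0 \<le> B" using \<rho>0 \<gamma>0 by (simp add: B_def)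
  ultimately have close: "norm (y \<tau> - z (\<tau> - 1)) \<le> B" if "\<tau> \<in> {1..M}" for \<tau>
    unfolding z_def using that \<eta>0 assms(3,4) y1 step gbar gG \<open>{1..<M} \<subseteq> {1..T}\<close>
    by (intro ofw_iterates_close[OF K, where a = "\<eta> * G" and \<beta> = "\<beta>\<^sub>K" and m = M])
      (auto intro!: mult_left_mono simp: subset_eq)
  \<comment> \<open>A gradient never arrives before the round of its decision, so the counter at
    that decision has not passed \<open>\<tau>\<close>. For \<open>\<tau> \<ge> M\<close> the bound
    \<open>M\<close> on the counter suffices.\<close>
  have lag: "N (c' \<tau>) \<le> \<tau>" if "\<tau> \<in> {1..T}" for \<tau>
  proof (cases "\<tau> < M")
    case True
    with that have "\<tau> \<in> {1..<M}" by simp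
    then obtain t where t: "t \<in> {1..T}" "\<tau> \<in> {N t..<N (Suc t)}"
      unfolding M_def N_def by (rule ofw_counter_block)
    then have "c' \<tau> \<in> arrivals T d t"
      using c'(2)[of \<tau>] True that bij_betwE[OF c[OF t(1)]] by auto
    then have "c' \<tau> \<le> t" using d by (fastforce simp: arrivals_def)
    then have "N (c' \<tau>) \<le> N t" unfolding N_def by (rule ofw_counter_mono)
    then show ?thesis using t by simp
  next
    case False
    then show ?thesis using N_range[OF c'T[OF that]] by simp
  qed
  \<comment> \<open>The path from \<open>y n\<close> to \<open>z \<tau>\<close> goes through
    \<open>z (n - 1)\<close>: closeness of the iterates, then stability. The lag
    \<open>\<tau> - (n - 1)\<close> includes \<open>g \<tau>\<close> itself, since
    \<open>be_the_leader\<close> speaks of \<open>z \<tau>\<close>.\<close>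
  have bound: "g \<tau> \<bullet> (x (c' \<tau>) - xstar) \<le> g \<tau> \<bullet> (z \<tau> - xstar) + G * B
      + \<eta> / 2 * G\<^sup>2 * (real \<tau> + 1 - real (N (c' \<tau>)))" if \<tau>: "\<tau> \<in> {1..T}" for \<tau>
  proof -
    define n where "n = N (c' \<tau>)"
    have n: "n \<in> {1..M}" "n \<le> \<tau>" unfolding n_def using N_range c'T \<tau> lag by auto
    have xn: "x (c' \<tau>) = y n" using x c'T[OF \<tau>] by (simp add: n_def)
    have "norm (z (n - 1) - z \<tau>) \<le> \<eta> / 2 * (real (\<tau> - (n - 1)) * G)"
      unfolding z_def using \<eta>0 n \<tau> gG by (intro ofw_minimizer_drift[OF K]) auto
    also have "real (\<tau> - (n - 1)) = real \<tau> + 1 - real n" using n by (simp add: of_nat_diff)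
    finally have "norm (y n - z \<tau>) \<le> B + \<eta> / 2 * ((real \<tau> + 1 - real n) * G)"
      using close[OF n(1)] norm_triangle_ineq[of "y n - z (n - 1)" "z (n - 1) - z \<tau>"] by simp
    then have "g \<tau> \<bullet> (y n - z \<tau>) \<le> G * (B + \<eta> / 2 * ((real \<tau> + 1 - real n) * G))"
      using gG[OF \<tau>] \<open>G > 0\<close>
      by (intro order_trans[OF norm_cauchy_schwarz] mult_mono) auto
    also have "\<dots> = G * B + \<eta> / 2 * G\<^sup>2 * (real \<tau> + 1 - real n)"
      by (simp add: power2_eq_square algebra_simps add_divide_distrib diff_divide_distrib)
    finally show ?thesis by (simp add: xn inner_diff_right n_def)
  qed
  have lead: "(\<Sum>\<tau>=1..T. g \<tau> \<bullet> (z \<tau> - xstar)) \<le> D\<^sup>2 / \<eta>"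
  proof -
    have "\<eta> * (\<Sum>\<tau>=1..T. g \<tau> \<bullet> (z \<tau> - xstar)) \<le> (norm (xstar - y 1))\<^sup>2"
      unfolding z_def using y1 assms(14) by (intro be_the_leader[OF K])
    also have "\<dots> \<le> D\<^sup>2" using assms(7,14) y1 by (intro power_mono) auto
    finally show ?thesis using \<eta>0 by (simp add: field_simps)
  qed
  \<comment> \<open>As \<open>c'\<close> permutes the rounds, the lags have the same sum in order of
    consumption as in order of play.\<close>
  have delay: "(\<Sum>\<tau>=1..T. real \<tau> + 1 - real (N (c' \<tau>))) \<le> (\<Sum>k=1..T. real (d k))"
    using sum_ofw_counter[OF d] sum.reindex_bij_betw[OF c'(1), of "\<lambda>t. real (N t)"]
    by (simp add: sum.distrib sum_subtractf N_def)
  have "(\<Sum>t=1..T. f t (x t)) - (\<Sum>t=1..T. f t xstar) = (\<Sum>t=1..T. f t (x t) - f t xstar)"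
    by (simp add: sum_subtractf)
  also have "\<dots> \<le> (\<Sum>t=1..T. grad t (x t) \<bullet> (x t - xstar))"
    by (intro sum_mono convex_on_gradient_ineq[where K = K] assms(8,9,14) xK)
  also have "\<dots> = (\<Sum>\<tau>=1..T. g \<tau> \<bullet> (x (c' \<tau>) - xstar))"
    unfolding g_def by (rule sum.reindex_bij_betw[OF c'(1), symmetric])
  also have "\<dots> \<le> (\<Sum>\<tau>=1..T. g \<tau> \<bullet> (z \<tau> - xstar) + G * B
      + \<eta> / 2 * G\<^sup>2 * (real \<tau> + 1 - real (N (c' \<tau>))))"
    by (rule sum_mono) (rule bound)
  also have "\<dots> = (\<Sum>\<tau>=1..T. g \<tau> \<bullet> (z \<tau> - xstar)) + real T * (G * B)
      + \<eta> / 2 * G\<^sup>2 * (\<Sum>\<tau>=1..T. real \<tau> + 1 - real (N (c' \<tau>)))"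
    by (simp add: sum.distrib sum_distrib_left)
  also have "\<dots> \<le> D\<^sup>2 / \<eta> + real T * (G * B) + \<eta> / 2 * G\<^sup>2 * (\<Sum>k=1..T. real (d k))"
    using lead delay \<eta>0 \<open>G > 0\<close> by (intro add_mono mult_left_mono) auto
  finally have "(\<Sum>t=1..T. f t (x t)) - (\<Sum>t=1..T. f t xstar)
    \<le> D\<^sup>2 / \<eta> + real T * (G * B) + \<eta> / 2 * G\<^sup>2 * (\<Sum>k=1..T. real (d k))" .
  moreover have "D\<^sup>2 / \<eta> = G * (2 * D) * real T powr (2 / 3)"
    unfolding \<eta>_def using \<open>D > 0\<close> by (simp add: power2_eq_square)
  moreover have "real T * (G * B) = G * (sqrt \<gamma> / 2) * real T powr (2 / 3)"
    by (simp add: B_def powr23)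
  moreover have "\<eta> / 2 * G\<^sup>2 * (\<Sum>k=1..T. real (d k)) =
      G * D * \<delta> * real T powr (1 / 3) / 4"
  proof -
    have "\<eta> / 2 * G\<^sup>2 = (\<eta> * G) * G / 2" by (simp add: power2_eq_square)
    then show ?thesis using \<open>T \<ge> 1\<close> by (simp add: \<eta>G powr13 \<delta>_def)
  qed
  \<comment> \<open>The last two inequalities round constants up: \<open>\<delta> / 4\<close> to
    \<open>(1 + \<delta>) / 2\<close>, and \<open>sqrt \<gamma> / 2\<close> to
    \<open>3 * sqrt \<gamma>\<close>.\<close>
  moreover have "G * D * \<delta> * real T powr (1 / 3) / 4 \<le> G * D * (1 + \<delta>) * real T powr (1 / 3) / 2"
    using \<open>G > 0\<close> \<open>D > 0\<close> \<delta>0 by (intro frac_le mult_right_mono mult_left_mono) auto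
  moreover have "G * (2 * D) * real T powr (2 / 3) + G * (sqrt \<gamma> / 2) * real T powr (2 / 3)
      \<le> G * (3 * sqrt \<gamma> + 2 * D) * real T powr (2 / 3)"
    using \<open>G > 0\<close> \<gamma>0 unfolding distrib_right[symmetric] distrib_left[symmetric]
    by (intro mult_right_mono mult_left_mono) auto
  ultimately show ?thesis
    unfolding \<gamma>_def[symmetric] \<delta>_def[symmetric] by linarith
qed

end
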